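(* Consider the $j$-th warden of the uplink satellite system described in the context, with parameters $m_j,\omega_j,\rho,\hat{\sigma}_{\mathrm{w}_j}^{\mathrm{lb}},\hat{\sigma}_{\mathrm{w}_j}^{\mathrm{ub}}$, and let $\check\xi_j^*$ denote the minimum over all detection thresholds $\tau_j$ of the function $\check\xi_j$ defined in the context. Then $$\check\xi_j^*\ >\ \check\xi_j^{\mathrm{lb}},\qquad\text{where}\qquad \check\xi_j^{\mathrm{lb}}\triangleq 1-\frac{\omega_j}{2\log(\rho)\,\hat{\sigma}_{\mathrm{w}_j}^{\mathrm{lb}}}.$$
   Context: Setting. A transmitter (Alice) with $M_{\mathrm a}$ antennas uses a unit-norm beamforming vector $\mathbf{w}_{\mathrm a}\in\mathbb{C}^{M_{\mathrm a}}$ and transmit power $P_{\mathrm a}>0$. The $j$-th warden is a satellite with $M_{\mathrm{sat}}$ antennas. The line-of-sight channel matrix is $\overline{\mathbf H}_{\mathrm a,\mathrm w_j}=\mathbf g_{\mathrm w_j,\mathrm a}\mathbf d_{\mathrm a,\mathrm w_j}^\dagger\in\mathbb{C}^{M_{\mathrm{sat}}\times M_{\mathrm a}}$, where $\mathbf g_{\mathrm w_j,\mathrm a}\in\mathbb{C}^{M_{\mathrm{sat}}}$ and $\mathbf d_{\mathrm a,\mathrm w_j}\in\mathbb{C}^{M_{\mathrm a}}$ are steering vectors (Kronecker products of vectors $[1,e^{-\jmath c x},\dots,e^{-\jmath (n-1) c x}]^T$ with $c,x$ real, so all entries have modulus 1), $\dagger$ is conjugate transpose, and the combining vector is $\mathbf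 v_{\mathrm w_j}=\mathbf g_{\mathrm w_j,\mathrm a}/\sqrt{M_{\mathrm{sat}}}$. $K\ge 0$ is the Rician factor; $F_{\mathrm a,\mathrm w_j},G_{\mathrm a,\mathrm w_j},G_{\mathrm w_j,\mathrm a}>0$ are the free space loss and the two antenna gains. Parameters. $\kappa_j=K|\mathbf v_{\mathrm w_j}^\dagger\overline{\mathbf H}_{\mathrm a,\mathrm w_j}\mathbf w_{\mathrm a}|^2$, $\ \omega_j=F_{\mathrm a,\mathrm w_j}G_{\mathrm a,\mathrm w_j}G_{\mathrm w_j,\mathrm a}P_{\mathrm a}(1+\kappa_j)/(1+K)>0$, $\ m_j=(\kappa_j+1)^2/(2\kappa_j+1)\ge 1$. With nominal noise power $\overline\sigma_{\mathrm w_j}^2>0$ and noise uncertainty $\rho>1$: $\hat\sigma_{\mathrm w_j}^{\mathrm{lb}}=\overline\sigma_{\mathrm w_j}^2/\rho$ and $\hat\sigma_{\mathrm w_j}^{\mathrm{ub}}=\rho\,\overline\sigma_{\mathrm w_j}^2$. $\log$ is the natural logarithm, $\Gamma(a)$ the Gamma function, $\gamma(a,x)=\int_0^x t^{a-1}e^{-t}dt$ the lower incomplete Gamma function, and $\mu_j(x)=m_j(x-\hat\sigma_{\mathrm w_j}^{\mathrm{lb}})/\omega_j$. Lower bound on the detection error probability. For $\tau>\hat\sigma_{\mathrm w_j}^{\mathrm{lb}}$ let $$\check F_{Z_j}(\tau)=\frac{\omega_j\log\big(\tau/\hat\sigma_{\mathrm w_j}^{\mathrm{lb}}\big)\big(\gamma(m_j+1,\mu_j(\tau))-\mu_j(\tau)\gamma(m_j,\mu_j(\tau))\big)}{2\log(\rho)\,\Gamma(m_j+1)\,(\hat\sigma_{\mathrm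 w_j}^{\mathrm{lb}}-\tau)},$$ and $\check F_{Z_j}(\hat\sigma_{\mathrm w_j}^{\mathrm{lb}})=0$ (its limit). As a function of the threshold $\tau_j\in\mathbb{R}$, $$\check\xi_j=\begin{cases}1,&\tau_j<\hat\sigma_{\mathrm w_j}^{\mathrm{lb}},\\[1mm] \dfrac{\log(\hat\sigma_{\mathrm w_j}^{\mathrm{ub}})-\log(\tau_j)}{2\log(\rho)}+\check F_{Z_j}(\tau_j),&\hat\sigma_{\mathrm w_j}^{\mathrm{lb}}\le\tau_j\le\hat\sigma_{\mathrm w_j}^{\mathrm{ub}},\\[1mm] \check F_{Z_j}(\tau_j),&\tau_j>\hat\sigma_{\mathrm w_j}^{\mathrm{ub}}.\end{cases}$$ *)

theory Defs
  imports "HOL-Analysis.Gamma_Function" "Jordan_Normal_Form.Matrix"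
begin

no_notation inner (infix \<open>\<bullet>\<close> 70)
no_notation Finite_Cartesian_Product.vec_nth (infixl \<open>$\<close> 90)

definition line_response :: "nat \<Rightarrow> real \<Rightarrow> real \<Rightarrow> complex Matrix.vec" where
  "line_response n c x = Matrix.vec n (\<lambda>k. exp (- \<i> * of_nat k * of_real c * of_real x))"

definition kron_vec :: "complex Matrix.vec \<Rightarrow> complex Matrix.vec \<Rightarrow> complex Matrix.vec" where
  "kron_vec u v = Matrix.vec (dim_vec u * dim_vec v)
     (\<lambda>i. u $ (i div dim_vec v) * v $ (i mod dim_vec v))"

text \<open>Kronecker products of one or more line responses, so linear and planar arrays of any
  size are covered.\<close>

inductive steering_vector :: "complex Matrix.vec \<Rightarrow> bool" where
  line: "n \<ge> 1 \<Longrightarrow> steering_vector (line_response n c x)"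
| kron: "steering_vector u \<Longrightarrow> steering_vector v \<Longrightarrow> steering_vector (kron_vec u v)"

text \<open>The rank-one matrix \<open>g d\<^sup>\<dagger>\<close>.\<close>

definition los_channel :: "complex Matrix.vec \<Rightarrow> complex Matrix.vec \<Rightarrow> complex Matrix.mat" where
  "los_channel g d = Matrix.mat (dim_vec g) (dim_vec d) (\<lambda>(i, j). g $ i * cnj (d $ j))"

definition combiner :: "complex Matrix.vec \<Rightarrow> complex Matrix.vec" where
  "combiner g = (1 / of_real (sqrt (real (dim_vec g)))) \<cdot>\<^sub>v g"

text \<open>\<open>u \<bullet>c v\<close> conjugates its second argument, so \<open>v\<^sup>\<dagger> H w\<close> is \<open>(H *\<^sub>v w) \<bullet>c v\<close>.\<close>

definition kappa_par ::
  "real \<Rightarrow> complex Matrix.vec \<Rightarrow> complex Matrix.mat \<Rightarrow> complex Matrix.vec \<Rightarrow> real" where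
  "kappa_par K v H w = K * (cmod ((H *\<^sub>v w) \<bullet>c v))\<^sup>2"

text \<open>The integrand is \<open>0\<close> at \<open>t = 0\<close> because \<open>0 powr b = 0\<close>; this single point does not
  affect the integral.\<close>

definition lower_gamma :: "real \<Rightarrow> real \<Rightarrow> real" where
  "lower_gamma a x = integral {0..x} (\<lambda>t. t powr (a - 1) * exp (- t))"

definition mu_par :: "real \<Rightarrow> real \<Rightarrow> real \<Rightarrow> real \<Rightarrow> real" where
  "mu_par m \<omega> lb x = m * (x - lb) / \<omega>"

definition F_check :: "real \<Rightarrow> real \<Rightarrow> real \<Rightarrow> real \<Rightarrow> real \<Rightarrow> real" where
  "F_check m \<omega> \<rho> lb \<tau> =
     (if \<tau> = lb then 0
      else \<omega> * ln (\<tau> / lb) *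
           (lower_gamma (m + 1) (mu_par m \<omega> lb \<tau>)
              - mu_par m \<omega> lb \<tau> * lower_gamma m (mu_par m \<omega> lb \<tau>))
           / (2 * ln \<rho> * Gamma (m + 1) * (lb - \<tau>)))"

text \<open>\<open>lb\<close> and \<open>ub\<close> are the ends of the interval of possible noise powers.\<close>

definition xi_check :: "real \<Rightarrow> real \<Rightarrow> real \<Rightarrow> real \<Rightarrow> real \<Rightarrow> real \<Rightarrow> real" where
  "xi_check m \<omega> \<rho> lb ub \<tau> =
     (if \<tau> < lb then 1
      else if \<tau> \<le> ub then (ln ub - ln \<tau>) / (2 * ln \<rho>) + F_check m \<omega> \<rho> lb \<tau>
      else F_check m \<omega> \<rho> lb \<tau>)"

end

theory Submission
  imports Defs
begin

text \<open>With \<open>x = \<tau> - lb > 0\<close>, \<open>\<mu> = m x / \<omega>\<close> and \<open>L = ln (\<tau> / lb)\<close>, one has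
  \<open>F_check = L / (2 ln \<rho>) * h \<mu> / Gamma m\<close>, where
  \<open>h \<mu> = \<integral>\<^sub>0\<^sup>\<mu> (1 - t / \<mu>) t\<^sup>m\<^sup>-\<^sup>1 e\<^sup>-\<^sup>t dt\<close> increases with \<open>\<mu>\<close> and stays between \<open>0\<close> and \<open>Gamma m\<close>.
  Hence \<open>F_check\<close> is nonnegative and increasing and tends to \<open>0\<close> at \<open>lb\<close>; so \<open>xi_check\<close> attains
  its minimum on the compact interval \<open>[lb, ub]\<close>. Since the integrand is negative beyond \<open>\<mu>\<close>,
  extending the integral to infinity gives \<open>h \<mu> \<ge> Gamma m - Gamma (m + 1) / \<mu>\<close>, that is
  \<open>h \<mu> / Gamma m \<ge> 1 - \<omega> / x\<close>. The bound then follows from \<open>L < x / lb\<close>.\<close>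

text \<open>The \<open>h\<close> of the overview, written with \<open>lower_gamma\<close> to match
  the numerator of \<open>F_check\<close>. For \<open>m > 0\<close> and \<open>\<mu> > 0\<close> it
  is \<open>Gamma m\<close> times the expectation of \<open>max 0 (1 - X / \<mu>)\<close>, where
  \<open>X\<close> is Gamma distributed with shape \<open>m\<close> and scale 1.\<close>

definition hinge_gamma :: "real \<Rightarrow> real \<Rightarrow> real" where
  "hinge_gamma m \<mu> = lower_gamma m \<mu> - lower_gamma (m + 1) \<mu> / \<mu>"

section \<open>The lower incomplete Gamma integral\<close>

lemma has_integral_Gamma:
  fixes m :: real
  assumes "m > 0"
  shows "((\<lambda>t. t powr (m - 1) * exp (- t)) has_integral Gamma m) {0..}"
  using Gamma_integral_real[OF assms] by (simp add: exp_minus divide_inverse)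

lemma integrable_lower_gamma:
  fixes m x :: real
  assumes "m > 0"
  shows "(\<lambda>t. t powr (m - 1) * exp (- t)) integrable_on {0..x}"
  using has_integral_Gamma[OF assms] by (meson Icc_subset_Ici_iff has_integral_integrable
      integrable_on_subinterval order_refl)

lemma has_integral_lower_gamma:
  assumes "m > 0"
  shows "((\<lambda>t. t powr (m - 1) * exp (- t)) has_integral lower_gamma m x) {0..x}"
  unfolding lower_gamma_def using integrable_lower_gamma[OF assms] by (rule integrable_integral)

lemma lower_gamma_nonneg: "m > 0 \<Longrightarrow> 0 \<le> lower_gamma m x"
  by (rule has_integral_nonneg[OF has_integral_lower_gamma]) auto

lemma lower_gamma_le_Gamma: "m > 0 \<Longrightarrow> lower_gamma m x \<le> Gamma m"
  by (rule has_integral_subset_le[OF _ has_integral_lower_gamma has_integral_Gamma]) auto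

lemma continuous_on_lower_gamma:
  assumes "m > 0"
  shows "continuous_on {0..} (lower_gamma m)"
proof -
  have "isCont (lower_gamma m) x" if "x \<in> {0<..}" for x
  proof -
    have "continuous_on {0..x+1} (lower_gamma m)"
      unfolding lower_gamma_def
      by (rule indefinite_integral_continuous_1[OF integrable_lower_gamma[OF assms]])
    then show ?thesis
      by (rule continuous_on_interior) (use that in simp)
  qed
  moreover have "continuous (at 0 within {0..}) (lower_gamma m)"
  proof -
    have "continuous_on {0..1} (lower_gamma m)"
      unfolding lower_gamma_def
      by (rule indefinite_integral_continuous_1[OF integrable_lower_gamma[OF assms]])
    then have "continuous (at 0 within {0..1}) (lower_gamma m)"
      by (simp add: continuous_on_eq_continuous_within)
    \<comment> \<open>The right end 1 is invisible at 0: both sets agree on the neighbourhood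
      \<open>{..<1}\<close>.\<close>
    moreover have "at 0 within {0..1} = at (0::real) within {0..}"
      by (rule at_within_nhd[of _ "{..<1}"]) auto
    ultimately show ?thesis by (simp add: continuous_within)
  qed
  ultimately show ?thesis
    unfolding continuous_on_eq_continuous_within
    by (metis atLeast_iff continuous_at_imp_continuous_at_within greaterThan_iff order_le_less)
qed

section \<open>The hinge integral: sign, monotonicity, bounds\<close>

text \<open>The exponent \<open>m + 1 - 1\<close> is left unsimplified so that it matches the
  integrand of \<open>lower_gamma (m + 1)\<close>. At \<open>t = 0\<close> both sides vanish because
  \<open>0 powr b = 0\<close>.\<close>

lemma hinge_integrand:
  "t \<ge> 0 \<Longrightarrow> t powr (m - 1) * exp (- t) - t powr (m + 1 - 1) * exp (- t) / \<mu> =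
    (1 - t / \<mu>) * (t powr (m - 1) * exp (- t))" for t m \<mu> :: real
  using powr_mult_base[of t "m - 1"] by (simp add: algebra_simps flip: mult.assoc)

lemma has_integral_hinge_gamma:
  assumes "m > 0"
  shows "((\<lambda>t. (1 - t / \<mu>) * (t powr (m - 1) * exp (- t))) has_integral hinge_gamma m \<mu>) {0..\<mu>}"
proof -
  have "((\<lambda>t. t powr (m - 1) * exp (- t) - t powr (m + 1 - 1) * exp (- t) / \<mu>)
      has_integral hinge_gamma m \<mu>) {0..\<mu>}"
    unfolding hinge_gamma_def using assms
    by (intro has_integral_diff has_integral_divide has_integral_lower_gamma) auto
  then show ?thesis
    by (rule has_integral_eq[rotated]) (use hinge_integrand in auto)
qed

lemma hinge_gamma_nonneg: "m > 0 \<Longrightarrow> \<mu> > 0 \<Longrightarrow> 0 \<le> hinge_gamma m \<mu>"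
  by (rule has_integral_nonneg[OF has_integral_hinge_gamma]) auto

lemma hinge_gamma_le_Gamma:
  assumes "m > 0" "\<mu> > 0"
  shows "hinge_gamma m \<mu> \<le> Gamma m"
  using lower_gamma_le_Gamma[of m \<mu>] lower_gamma_nonneg[of "m + 1" \<mu>] assms
  by (simp add: hinge_gamma_def) (smt (verit) divide_nonneg_pos)

text \<open>Both integrals are compared pointwise on \<open>{0..\<nu>}\<close>, the smaller one
  extended by 0: the factor \<open>1 - t / \<mu>\<close> grows with \<open>\<mu>\<close>, and
  between \<open>\<mu>\<close> and \<open>\<nu>\<close> the larger integrand is nonnegative.\<close>

lemma hinge_gamma_mono:
  assumes "m > 0" "0 < \<mu>" "\<mu> \<le> \<nu>"
  shows "hinge_gamma m \<mu> \<le> hinge_gamma m \<nu>"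
proof -
  have "((\<lambda>t. if t \<in> {0..\<mu>} then (1 - t / \<mu>) * (t powr (m - 1) * exp (- t)) else 0)
      has_integral hinge_gamma m \<mu>) {0..\<nu>}"
    using has_integral_hinge_gamma[OF assms(1), of \<mu>] assms
    by (subst has_integral_restrict) auto
  moreover have "(if t \<in> {0..\<mu>} then (1 - t / \<mu>) * (t powr (m - 1) * exp (- t)) else 0)
      \<le> (1 - t / \<nu>) * (t powr (m - 1) * exp (- t))" if "t \<in> {0..\<nu>}" for t
    using that assms by (auto intro!: mult_right_mono divide_left_mono)
  ultimately show ?thesis
    by (rule has_integral_le[OF _ has_integral_hinge_gamma[OF assms(1)]])
qed

lemma hinge_gamma_ge:
  assumes "m > 0" "\<mu> > 0"
  shows "Gamma m - Gamma (m + 1) / \<mu> \<le> hinge_gamma m \<mu>"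
proof -
  have "((\<lambda>t. t powr (m - 1) * exp (- t) - t powr (m + 1 - 1) * exp (- t) / \<mu>)
      has_integral Gamma m - Gamma (m + 1) / \<mu>) {0..}"
    using assms by (intro has_integral_diff has_integral_divide has_integral_Gamma) auto
  moreover have "((\<lambda>t. if t \<in> {0..\<mu>} then (1 - t / \<mu>) * (t powr (m - 1) * exp (- t)) else 0)
      has_integral hinge_gamma m \<mu>) {0..}"
    using has_integral_hinge_gamma[OF assms(1), of \<mu>] by (subst has_integral_restrict) auto
  moreover have "t powr (m - 1) * exp (- t) - t powr (m + 1 - 1) * exp (- t) / \<mu>
      \<le> (if t \<in> {0..\<mu>} then (1 - t / \<mu>) * (t powr (m - 1) * exp (- t)) else 0)"
    if "t \<in> {0..}" for t
  proof (cases "t \<le> \<mu>")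
    case False
    then have "(1 - t / \<mu>) * (t powr (m - 1) * exp (- t)) \<le> 0"
      using assms by (intro mult_nonpos_nonneg) auto
    then show ?thesis using False that hinge_integrand[of t m \<mu>] by auto
  qed (use that hinge_integrand[of t m \<mu>] in auto)
  ultimately show ?thesis by (rule has_integral_le)
qed

lemma continuous_on_hinge_gamma:
  assumes "m > 0"
  shows "continuous_on {0<..} (hinge_gamma m)"
  unfolding hinge_gamma_def using assms
  by (intro continuous_intros continuous_on_subset[OF continuous_on_lower_gamma]) auto

section \<open>The false alarm term \<open>F_check\<close>\<close>

locale detection =
  fixes m \<omega> \<rho> lb ub :: real
  assumes m_pos: "m > 0" and omega_pos: "\<omega> > 0" and rho: "\<rho> > 1"
    and lb_pos: "lb > 0" and ub: "ub = \<rho>\<^sup>2 * lb"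
begin

lemma ln_rho_pos: "ln \<rho> > 0"
  using rho by simp

lemma Gamma_m: "Gamma m > 0" "Gamma m \<noteq> 0" "Gamma (m + 1) = m * Gamma m"
proof -
  show "Gamma m > 0" using m_pos by (rule Gamma_real_pos)
  then show "Gamma m \<noteq> 0" by linarith
  show "Gamma (m + 1) = m * Gamma m"
    using m_pos Gamma_plus1[of m] by (auto simp: nonpos_Ints_def)
qed

lemma lb_less_ub: "lb < ub"
  using rho lb_pos ub by (simp add: power_strict_increasing[of 0 2])

lemma ln_ub: "ln ub = 2 * ln \<rho> + ln lb"
  using rho lb_pos by (simp add: ub ln_mult ln_realpow)

lemma mu_pos: "\<tau> > lb \<Longrightarrow> mu_par m \<omega> lb \<tau> > 0"
  using m_pos omega_pos by (simp add: mu_par_def)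

text \<open>The numerator of \<open>F_check\<close> contains
  \<open>- \<mu> * hinge_gamma m \<mu>\<close> and
  \<open>lb - \<tau> = - \<omega> * \<mu> / m\<close>, so signs, \<open>\<omega>\<close> and
  \<open>\<mu>\<close> cancel; \<open>Gamma (m + 1) = m * Gamma m\<close> removes
  \<open>m\<close>.\<close>

lemma F_check_eq:
  assumes "\<tau> > lb"
  shows "F_check m \<omega> \<rho> lb \<tau> =
    ln (\<tau> / lb) / (2 * ln \<rho>) * (hinge_gamma m (mu_par m \<omega> lb \<tau>) / Gamma m)"
proof -
  define \<mu> where "\<mu> = mu_par m \<omega> lb \<tau>"
  have mu: "\<mu> > 0" and tau: "\<tau> - lb = \<omega> * \<mu> / m"
    using mu_pos[OF assms] m_pos omega_pos by (auto simp: \<mu>_def mu_par_def)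
  have neg: "lb - \<tau> = - (\<omega> * \<mu> / m)" using tau by simp
  show ?thesis
    unfolding F_check_def \<mu>_def[symmetric] hinge_gamma_def neg Gamma_m(3)
    using assms mu m_pos omega_pos Gamma_m(1) ln_rho_pos
    by (simp add: divide_simps del: ln_divide_pos) (simp add: algebra_simps del: ln_divide_pos)
qed

lemma ln_ratio_pos: "\<tau> > lb \<Longrightarrow> ln (\<tau> / lb) > 0"
  using lb_pos by simp

lemma F_check_nonneg: "\<tau> > lb \<Longrightarrow> 0 \<le> F_check m \<omega> \<rho> lb \<tau>"
  using hinge_gamma_nonneg[OF m_pos mu_pos] ln_ratio_pos[of \<tau>] ln_rho_pos m_pos
  by (simp add: F_check_eq del: ln_divide_pos)

text \<open>Upper half of the squeeze that gives continuity at \<open>lb\<close>.\<close>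

lemma F_check_le:
  assumes "\<tau> > lb"
  shows "F_check m \<omega> \<rho> lb \<tau> \<le> ln (\<tau> / lb) / (2 * ln \<rho>)"
proof -
  have "hinge_gamma m (mu_par m \<omega> lb \<tau>) / Gamma m \<le> 1"
    using hinge_gamma_le_Gamma[OF m_pos mu_pos[OF assms]] m_pos by simp
  then show ?thesis
    unfolding F_check_eq[OF assms]
    using ln_ratio_pos[OF assms] ln_rho_pos by (intro mult_left_le) auto
qed

lemma F_check_mono:
  assumes "lb < \<sigma>" "\<sigma> \<le> \<tau>"
  shows "F_check m \<omega> \<rho> lb \<sigma> \<le> F_check m \<omega> \<rho> lb \<tau>"
proof -
  have less: "lb < \<tau>" using assms by simp
  have "ln (\<sigma> / lb) \<le> ln (\<tau> / lb)"
    using assms lb_pos by (simp add: divide_right_mono)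
  moreover have "mu_par m \<omega> lb \<sigma> \<le> mu_par m \<omega> lb \<tau>"
    using assms m_pos omega_pos by (simp add: mu_par_def divide_right_mono)
  then have "hinge_gamma m (mu_par m \<omega> lb \<sigma>) \<le> hinge_gamma m (mu_par m \<omega> lb \<tau>)"
    by (rule hinge_gamma_mono[OF m_pos mu_pos[OF assms(1)]])
  ultimately show ?thesis
    unfolding F_check_eq[OF assms(1)] F_check_eq[OF less]
    using hinge_gamma_nonneg[OF m_pos mu_pos[OF assms(1)]] ln_ratio_pos[OF less] ln_rho_pos m_pos
    by (intro mult_mono divide_right_mono) auto
qed

lemma F_check_gt:
  assumes "\<tau> > lb"
  shows "ln (\<tau> / lb) / (2 * ln \<rho>) - \<omega> / (2 * ln \<rho> * lb) < F_check m \<omega> \<rho> lb \<tau>"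
proof -
  let ?L = "ln (\<tau> / lb)"
  \<comment> \<open>Here \<open>Gamma (m + 1) / (\<mu> * Gamma m) = m / \<mu> = \<omega> / (\<tau> -
    lb)\<close>.\<close>
  have "1 - \<omega> / (\<tau> - lb) = (Gamma m - Gamma (m + 1) / mu_par m \<omega> lb \<tau>) / Gamma m"
    using Gamma_m(2,3) assms m_pos omega_pos
    by (simp add: mu_par_def diff_divide_distrib)
  also have "\<dots> \<le> hinge_gamma m (mu_par m \<omega> lb \<tau>) / Gamma m"
    using hinge_gamma_ge[OF m_pos mu_pos[OF assms]] Gamma_m(1) by (simp add: divide_right_mono)
  finally have "?L / (2 * ln \<rho>) * (1 - \<omega> / (\<tau> - lb)) \<le> F_check m \<omega> \<rho> lb \<tau>"
    unfolding F_check_eq[OF assms] using ln_ratio_pos[OF assms] ln_rho_pos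
    by (intro mult_left_mono) auto
  moreover have "?L < \<tau> / lb - 1"
  proof -
    \<comment> \<open>The source of strictness: \<open>ln x = x - 1\<close> only at
      \<open>x = 1\<close>, and \<open>\<tau> / lb > 1\<close>.\<close>
    have "?L \<noteq> \<tau> / lb - 1"
      using ln_eq_minus_one[of "\<tau> / lb"] assms lb_pos by auto
    moreover have "?L \<le> \<tau> / lb - 1"
      using assms lb_pos by (intro ln_le_minus_one) auto
    ultimately show ?thesis by simp
  qed
  then have "?L / (\<tau> - lb) * (\<omega> / (2 * ln \<rho>)) < 1 / lb * (\<omega> / (2 * ln \<rho>))"
    using assms lb_pos omega_pos ln_rho_pos
    by (intro mult_strict_right_mono) (auto simp: field_simps simp del: ln_divide_pos)
  ultimately show ?thesis
    by (simp add: right_diff_distrib diff_divide_distrib mult.commute del: ln_divide_pos)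
qed

lemma continuous_on_F_check: "continuous_on {lb..} (F_check m \<omega> \<rho> lb)"
  unfolding continuous_on_eq_continuous_within
proof
  fix \<tau> assume "\<tau> \<in> {lb..}"
  then consider "\<tau> = lb" | "\<tau> > lb" by fastforce
  then show "continuous (at \<tau> within {lb..}) (F_check m \<omega> \<rho> lb)"
  proof cases
    case 1
    have "((\<lambda>s. ln (s / lb) / (2 * ln \<rho>)) \<longlongrightarrow> ln (lb / lb) / (2 * ln \<rho>)) (at lb within {lb..})"
      using lb_pos ln_rho_pos by (intro tendsto_intros) auto
    then have lim: "((\<lambda>s. ln (s / lb) / (2 * ln \<rho>)) \<longlongrightarrow> 0) (at lb within {lb..})"
      using lb_pos by simp
    \<comment> \<open>The filter excludes \<open>lb\<close> itself, so the bounds valid for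
      \<open>\<tau> > lb\<close> suffice.\<close>
    have "(F_check m \<omega> \<rho> lb \<longlongrightarrow> 0) (at lb within {lb..})"
      by (rule tendsto_sandwich[OF _ _ tendsto_const lim])
        (auto simp: eventually_at_filter F_check_nonneg F_check_le
          simp del: ln_divide_pos intro!: always_eventually)
    then show ?thesis by (simp add: 1 continuous_within F_check_def)
  next
    case 2
    have "continuous_on {lb<..} (\<lambda>\<tau>. ln (\<tau> / lb) / (2 * ln \<rho>) *
        (hinge_gamma m (mu_par m \<omega> lb \<tau>) / Gamma m))"
      using lb_pos ln_rho_pos mu_pos m_pos omega_pos Gamma_m(2)
      by (intro continuous_intros continuous_on_compose2[OF continuous_on_hinge_gamma[OF m_pos]])
        (auto simp: mu_par_def intro!: continuous_intros)
    then have "continuous_on {lb<..} (F_check m \<omega> \<rho> lb)"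
      by (rule continuous_on_eq) (simp add: F_check_eq)
    then show ?thesis
      using 2 by (simp add: continuous_on_eq_continuous_at continuous_at_imp_continuous_at_within)
  qed
qed

section \<open>Minimum and strict lower bound of \<open>xi_check\<close>\<close>

lemma xi_check_attains_min: "\<exists>\<sigma>. \<forall>\<tau>. xi_check m \<omega> \<rho> lb ub \<sigma> \<le> xi_check m \<omega> \<rho> lb ub \<tau>"
proof -
  let ?xi = "xi_check m \<omega> \<rho> lb ub"
  have "continuous_on {lb..ub} (\<lambda>\<tau>. (ln ub - ln \<tau>) / (2 * ln \<rho>) + F_check m \<omega> \<rho> lb \<tau>)"
    using lb_pos ln_rho_pos
    by (intro continuous_intros continuous_on_subset[OF continuous_on_F_check]) auto
  then have "continuous_on {lb..ub} ?xi"
    by (rule continuous_on_eq) (simp add: xi_check_def)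
  then obtain \<sigma> where min: "\<And>\<tau>. \<tau> \<in> {lb..ub} \<Longrightarrow> ?xi \<sigma> \<le> ?xi \<tau>"
    using continuous_attains_inf[of "{lb..ub}" ?xi] lb_less_ub by fastforce
  have "?xi \<sigma> \<le> ?xi \<tau>" for \<tau>
  proof -
    consider "\<tau> < lb" | "\<tau> \<in> {lb..ub}" | "\<tau> > ub" by fastforce
    then show ?thesis
    proof cases
      case 1
      \<comment> \<open>The constant value 1 to the left of \<open>lb\<close> is already taken at
        \<open>lb\<close>, since \<open>ln ub - ln lb = 2 * ln \<rho>\<close>.\<close>
      have "?xi lb = 1"
        using lb_less_ub ln_rho_pos by (simp add: xi_check_def F_check_def ln_ub)
      then show ?thesis using 1 min[of lb] lb_less_ub by (simp add: xi_check_def)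
    next
      case 3
      \<comment> \<open>At \<open>ub\<close> the logarithmic summand vanishes, which leaves the
        increasing \<open>F_check\<close> on both sides.\<close>
      have "?xi ub \<le> ?xi \<tau>"
        using 3 lb_less_ub F_check_mono[of ub \<tau>] by (simp add: xi_check_def)
      then show ?thesis using min[of ub] lb_less_ub by simp
    qed (rule min)
  qed
  then show ?thesis by blast
qed

text \<open>Up to \<open>ub\<close> the logarithmic summand is
  \<open>1 - L / (2 * ln \<rho>)\<close> with \<open>L = ln (\<tau> / lb)\<close>, which cancels the
  \<open>L\<close> in \<open>F_check_gt\<close>. Beyond \<open>ub\<close> that summand is gone, but
  then \<open>L / (2 * ln \<rho>) > 1\<close>. Up to \<open>lb\<close> the value is 1.\<close>

lemma xi_check_gt: "xi_check m \<omega> \<rho> lb ub \<tau> > 1 - \<omega> / (2 * ln \<rho> * lb)"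
proof (cases "\<tau> > lb")
  case False
  have "\<omega> / (2 * ln \<rho> * lb) > 0" using omega_pos ln_rho_pos lb_pos by simp
  then show ?thesis
    using False lb_less_ub ln_rho_pos by (simp add: xi_check_def F_check_def ln_ub)
next
  case True
  have L: "ln (\<tau> / lb) = ln \<tau> - ln lb" using True lb_pos by (simp add: ln_div)
  show ?thesis
  proof (cases "\<tau> \<le> ub")
    case le: True
    have "(ln ub - ln \<tau>) / (2 * ln \<rho>) = 1 - ln (\<tau> / lb) / (2 * ln \<rho>)"
      unfolding L using ln_rho_pos by (simp add: ln_ub field_simps)
    then show ?thesis using le True F_check_gt[OF True] by (simp add: xi_check_def)
  next
    case False
    then have "ln ub < ln \<tau>" using lb_pos lb_less_ub by simp
    then have "1 < ln (\<tau> / lb) / (2 * ln \<rho>)"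
      unfolding L using ln_rho_pos by (simp add: ln_ub field_simps)
    then show ?thesis using False True F_check_gt[OF True] by (simp add: xi_check_def)
  qed
qed

end

theorem theorem1:
  fixes Ma Msat :: nat
    and w g d v :: "complex Matrix.vec"
    and H :: "complex Matrix.mat"
    and K Floss Gaw Gwa Pa sigma_sq \<rho> \<kappa> \<omega> m lb ub :: real
  assumes w: "w \<in> carrier_vec Ma" "w \<bullet>c w = 1"
    and g: "g \<in> carrier_vec Msat" "steering_vector g"
    and d: "d \<in> carrier_vec Ma" "steering_vector d"
    and H: "H = los_channel g d"
    and v: "v = combiner g"
    and K: "K \<ge> 0"
    and gains: "Floss > 0" "Gaw > 0" "Gwa > 0"
    and Pa: "Pa > 0"
    and noise: "sigma_sq > 0" "\<rho> > 1"
    and kappa: "\<kappa> = kappa_par K v H w"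
    and omega: "\<omega> = Floss * Gaw * Gwa * Pa * (1 + \<kappa>) / (1 + K)"
    and m: "m = (\<kappa> + 1)\<^sup>2 / (2 * \<kappa> + 1)"
    and lb: "lb = sigma_sq / \<rho>"
    and ub: "ub = \<rho> * sigma_sq"
  shows "\<exists>xi_star. xi_star \<in> range (xi_check m \<omega> \<rho> lb ub)
           \<and> (\<forall>\<tau>. xi_star \<le> xi_check m \<omega> \<rho> lb ub \<tau>)
           \<and> xi_star > 1 - \<omega> / (2 * ln \<rho> * lb)"
proof -
  \<comment> \<open>A nonnegative multiple of a square; this makes both \<open>\<omega>\<close> and
    \<open>m\<close> positive.\<close>
  have k: "\<kappa> \<ge> 0" using K by (simp add: kappa kappa_par_def)
  have "\<rho> * sigma_sq = \<rho>\<^sup>2 * lb" using noise by (simp add: lb power2_eq_square)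
  then interpret detection m \<omega> \<rho> lb ub
    using k K gains Pa noise by unfold_locales (auto simp: m omega lb ub)
  \<comment> \<open>The witness is an attained value, so the pointwise strict bound applies to it
    directly.\<close>
  show ?thesis using xi_check_attains_min xi_check_gt by blast
qed

end
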